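(* Let $n$ be a positive integer and let $A\in\Sigma_{n^2}$ be an $n^2\times n^2$ S-permutation matrix. Then the number $\xi_n$ of all matrices $B\in\Sigma_{n^2}$ which are disjoint with $A$ is equal to $$\xi_n=(n!)^{2n}+\sum_{k=1}^{n^2}(-1)^k\left(\sum_{\overline{g}\in\overline{\mathfrak{G}}_{n,k}}|\overline{g}|\left(\prod_{i=0}^{n-2}\left[(n-i)!\right]^{\psi_i(\overline{g})}\right)\right).$$
   Context: A binary matrix is a matrix with all entries in $\{0,1\}$. An $n^2\times n^2$ matrix is divided by $n-1$ horizontal and $n-1$ vertical lines into $n^2$ non-intersecting $n\times n$ square sub-matrices $A_{kl}$, $1\le k,l\le n$, called blocks. An $n^2\times n^2$ binary matrix is an S-permutation matrix if each row, each column and each block contains exactly one $1$; $\Sigma_{n^2}$ is the set of all $n^2\times n^2$ S-permutation matrices. Two binary matrices $A=(a_{ij})$ and $B=(b_{ij})$ of the same size are disjoint if there are no indices $i,j$ with $a_{ij}=b_{ij}=1$. For $0\le k\le n^2$, $\mathfrak{G}_{n,k}$ denotes the set of all bipartite graphs $g=\langle R_g\cup C_g,E_g\rangle$ without multiple edges on the fixed disjoint vertex sets $R_g=\{r_1,\dots,r_n\}$, $C_g=\{c_1,\dots,c_n\}$, with $E_g\subseteq R_g\times C_g$ and $|E_g|=k$. Two such graphs $g',g''$ are isomorphic, $g'\cong g''$, if there are bijections $\rho:R_{g'}\to R_{g''}$ and $\sigma:C_{g'}\to C_{g''}$ such that $\langle r,c\rangle\in E_{g'}\iff\langle\rho(r),\sigma(c)\rangle\in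 E_{g''}$ (in particular the two sides are not interchanged). $\overline{\mathfrak{G}}_{n,k}$ is the set of equivalence classes of $\mathfrak{G}_{n,k}$ under $\cong$; $\overline{g}=\{h\in\mathfrak{G}_{n,k} : h\cong g\}$ is the class of $g$ and $|\overline{g}|$ is its cardinality. For $i=0,1,\dots,n$, $\psi_i(g)$ is the number of vertices of $g$ (in $R_g\cup C_g$) incident to exactly $i$ edges; it depends only on the class, and $\psi_i(\overline{g})=\psi_i(g)$. An empty product equals $1$. *)

theory Defs
  imports "Jordan_Normal_Form.Matrix"
begin

section \<open>S-permutation matrices\<close>

(* Matrices and blocks are indexed from 0, as is usual for this matrix type. *)

definition binary_mat :: "nat mat \<Rightarrow> bool" where
  "binary_mat A \<longleftrightarrow> elements_mat A \<subseteq> {0, 1}"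

definition block :: "nat \<Rightarrow> nat mat \<Rightarrow> nat \<Rightarrow> nat \<Rightarrow> nat mat" where
  "block n A k l = mat n n (\<lambda>(i, j). A $$ (k * n + i, l * n + j))"

definition S_permutation_mats :: "nat \<Rightarrow> nat mat set" where
  "S_permutation_mats n = {A \<in> carrier_mat (n\<^sup>2) (n\<^sup>2).
     binary_mat A \<and>
     (\<forall>i<n\<^sup>2. \<exists>!j. j < n\<^sup>2 \<and> A $$ (i, j) = 1) \<and>
     (\<forall>j<n\<^sup>2. \<exists>!i. i < n\<^sup>2 \<and> A $$ (i, j) = 1) \<and>
     (\<forall>k<n. \<forall>l<n. \<exists>!p. p \<in> {..<n} \<times> {..<n} \<and> block n A k l $$ p = 1)}"

definition disjoint_mats :: "nat mat \<Rightarrow> nat mat \<Rightarrow> bool" where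
  "disjoint_mats A B \<longleftrightarrow> dim_row A = dim_row B \<and> dim_col A = dim_col B \<and>
     \<not> (\<exists>i<dim_row A. \<exists>j<dim_col A. A $$ (i, j) = 1 \<and> B $$ (i, j) = 1)"


section \<open>Bipartite graphs with two distinguished sides\<close>

datatype vertex = Row nat | Col nat

record bgraph =
  rverts :: "vertex set"
  cverts :: "vertex set"
  edges :: "(vertex \<times> vertex) set"

definition bgraphs :: "nat \<Rightarrow> nat \<Rightarrow> bgraph set" where
  "bgraphs n k = {g. rverts g = Row ` {1..n} \<and> cverts g = Col ` {1..n} \<and>
     edges g \<subseteq> rverts g \<times> cverts g \<and> card (edges g) = k}"

definition bgraph_iso :: "bgraph \<Rightarrow> bgraph \<Rightarrow> bool" where
  "bgraph_iso g h \<longleftrightarrow> (\<exists>\<rho> \<sigma>. bij_betw \<rho> (rverts g) (rverts h) \<and> bij_betw \<sigma> (cverts g) (cverts h) \<and>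
     (\<forall>r\<in>rverts g. \<forall>c\<in>cverts g. (r, c) \<in> edges g \<longleftrightarrow> (\<rho> r, \<sigma> c) \<in> edges h))"

definition bgraph_iso_rel :: "nat \<Rightarrow> nat \<Rightarrow> (bgraph \<times> bgraph) set" where
  "bgraph_iso_rel n k = {(g, h). g \<in> bgraphs n k \<and> h \<in> bgraphs n k \<and> bgraph_iso g h}"

definition bgraph_classes :: "nat \<Rightarrow> nat \<Rightarrow> bgraph set set" where
  "bgraph_classes n k = bgraphs n k // bgraph_iso_rel n k"

definition vertex_degree :: "bgraph \<Rightarrow> vertex \<Rightarrow> nat" where
  "vertex_degree g v = card {e \<in> edges g. fst e = v \<or> snd e = v}"

definition psi :: "nat \<Rightarrow> bgraph \<Rightarrow> nat" where
  "psi i g = card {v \<in> rverts g \<union> cverts g. vertex_degree g v = i}"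

(* The common value of psi on an isomorphism class; see psi_class_eq for well-definedness. *)
definition psi_class :: "nat \<Rightarrow> bgraph set \<Rightarrow> nat" where
  "psi_class i \<gamma> = the_elem (psi i ` \<gamma>)"


lemma bgraph_iso_refl: "bgraph_iso g g"
  unfolding bgraph_iso_def by (rule exI[of _ id], rule exI[of _ id]) simp

lemma bgraph_iso_sym:
  assumes "bgraph_iso g h"
  shows "bgraph_iso h g"
proof -
  obtain \<rho> \<sigma> where b: "bij_betw \<rho> (rverts g) (rverts h)" "bij_betw \<sigma> (cverts g) (cverts h)"
    and e: "\<And>r c. r \<in> rverts g \<Longrightarrow> c \<in> cverts g \<Longrightarrow> (r, c) \<in> edges g \<longleftrightarrow> (\<rho> r, \<sigma> c) \<in> edges h"
    using assms unfolding bgraph_iso_def by blast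
  let ?\<rho> = "inv_into (rverts g) \<rho>" and ?\<sigma> = "inv_into (cverts g) \<sigma>"
  have b': "bij_betw ?\<rho> (rverts h) (rverts g)" "bij_betw ?\<sigma> (cverts h) (cverts g)"
    by (rule bij_betw_inv_into[OF b(1)], rule bij_betw_inv_into[OF b(2)])
  have "(r, c) \<in> edges h \<longleftrightarrow> (?\<rho> r, ?\<sigma> c) \<in> edges g" if "r \<in> rverts h" "c \<in> cverts h" for r c
  proof -
    have "?\<rho> r \<in> rverts g" "?\<sigma> c \<in> cverts g"
      using that bij_betw_apply[OF b'(1)] bij_betw_apply[OF b'(2)] by blast+
    from e[OF this] show ?thesis
      by (simp only: bij_betw_inv_into_right[OF b(1) that(1)] bij_betw_inv_into_right[OF b(2) that(2)])
  qed
  with b' show ?thesis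
    unfolding bgraph_iso_def by blast
qed

lemma bgraph_iso_trans:
  assumes "bgraph_iso f g" and "bgraph_iso g h"
  shows "bgraph_iso f h"
proof -
  obtain \<rho> \<sigma> where 1: "bij_betw \<rho> (rverts f) (rverts g)" "bij_betw \<sigma> (cverts f) (cverts g)"
    "\<forall>r\<in>rverts f. \<forall>c\<in>cverts f. (r, c) \<in> edges f \<longleftrightarrow> (\<rho> r, \<sigma> c) \<in> edges g"
    using assms(1) unfolding bgraph_iso_def by blast
  obtain \<rho>' \<sigma>' where 2: "bij_betw \<rho>' (rverts g) (rverts h)" "bij_betw \<sigma>' (cverts g) (cverts h)"
    "\<forall>r\<in>rverts g. \<forall>c\<in>cverts g. (r, c) \<in> edges g \<longleftrightarrow> (\<rho>' r, \<sigma>' c) \<in> edges h"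
    using assms(2) unfolding bgraph_iso_def by blast
  have "\<forall>r\<in>rverts f. \<forall>c\<in>cverts f. (r, c) \<in> edges f \<longleftrightarrow> ((\<rho>' \<circ> \<rho>) r, (\<sigma>' \<circ> \<sigma>) c) \<in> edges h"
    using 1 2 by (simp add: bij_betw_apply)
  then show ?thesis
    unfolding bgraph_iso_def using bij_betw_trans[OF 1(1) 2(1)] bij_betw_trans[OF 1(2) 2(2)] by blast
qed

lemma equiv_bgraph_iso_rel: "equiv (bgraphs n k) (bgraph_iso_rel n k)"
proof (rule equivI)
  show "bgraph_iso_rel n k \<subseteq> bgraphs n k \<times> bgraphs n k"
    by (auto simp: bgraph_iso_rel_def)
  show "refl_on (bgraphs n k) (bgraph_iso_rel n k)"
    by (simp add: refl_on_def bgraph_iso_rel_def bgraph_iso_refl)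
  show "sym (bgraph_iso_rel n k)"
    unfolding sym_def bgraph_iso_rel_def using bgraph_iso_sym by blast
  show "trans (bgraph_iso_rel n k)"
    unfolding trans_def bgraph_iso_rel_def using bgraph_iso_trans by blast
qed

lemma psi_bgraph_iso:
  assumes g: "g \<in> bgraphs n k" and h: "h \<in> bgraphs n k" and iso: "bgraph_iso g h"
  shows "psi i g = psi i h"
proof -
  obtain \<rho> \<sigma> where b: "bij_betw \<rho> (rverts g) (rverts h)" "bij_betw \<sigma> (cverts g) (cverts h)"
    and e: "\<And>r c. r \<in> rverts g \<Longrightarrow> c \<in> cverts g \<Longrightarrow> (r, c) \<in> edges g \<longleftrightarrow> (\<rho> r, \<sigma> c) \<in> edges h"
    using iso unfolding bgraph_iso_def by blast
  have dj: "rverts g \<inter> cverts g = {}" "rverts h \<inter> cverts h = {}"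
    and sub: "edges g \<subseteq> rverts g \<times> cverts g" "edges h \<subseteq> rverts h \<times> cverts h"
    using g h by (auto simp: bgraphs_def)
  define \<phi> where "\<phi> v = (if v \<in> rverts g then \<rho> v else \<sigma> v)" for v
  have \<phi>r: "\<phi> v = \<rho> v" if "v \<in> rverts g" for v using that by (simp add: \<phi>_def)
  have \<phi>c: "\<phi> v = \<sigma> v" if "v \<in> cverts g" for v using that dj by (auto simp: \<phi>_def)
  have br: "bij_betw \<phi> (rverts g) (rverts h)"
    using b(1) by (subst bij_betw_cong[OF \<phi>r])
  have bc: "bij_betw \<phi> (cverts g) (cverts h)"
    using b(2) by (subst bij_betw_cong[OF \<phi>c])
  have bij: "bij_betw \<phi> (rverts g \<union> cverts g) (rverts h \<union> cverts h)"
    by (rule bij_betw_combine[OF br bc dj(2)])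
  then have inj: "inj_on \<phi> (rverts g \<union> cverts g)" by (simp add: bij_betw_def)
  have deg: "vertex_degree h (\<phi> v) = vertex_degree g v" if v: "v \<in> rverts g \<union> cverts g" for v
  proof -
    have "bij_betw (map_prod \<phi> \<phi>) {e \<in> edges g. fst e = v \<or> snd e = v}
            {e \<in> edges h. fst e = \<phi> v \<or> snd e = \<phi> v}"
      unfolding bij_betw_def
    proof
      show "inj_on (map_prod \<phi> \<phi>) {e \<in> edges g. fst e = v \<or> snd e = v}"
        by (rule inj_on_subset[OF map_prod_inj_on[OF inj inj]]) (use sub in auto)
      show "map_prod \<phi> \<phi> ` {e \<in> edges g. fst e = v \<or> snd e = v} =
              {e \<in> edges h. fst e = \<phi> v \<or> snd e = \<phi> v}" (is "?L = ?R")
      proof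
        show "?L \<subseteq> ?R"
        proof
          fix x assume "x \<in> ?L"
          then obtain r c where rc: "(r, c) \<in> edges g" "r = v \<or> c = v" and x: "x = (\<phi> r, \<phi> c)"
            by auto
          from rc(1) sub have rg: "r \<in> rverts g" "c \<in> cverts g" by auto
          with rc(1) e[OF rg] have "(\<phi> r, \<phi> c) \<in> edges h" by (simp add: \<phi>r \<phi>c)
          with rc(2) x show "x \<in> ?R" by auto
        qed
        show "?R \<subseteq> ?L"
        proof
          fix x assume "x \<in> ?R"
          moreover obtain r' c' where x: "x = (r', c')" by (rule prod.exhaust)
          ultimately have rc: "(r', c') \<in> edges h" and inc: "r' = \<phi> v \<or> c' = \<phi> v"
            by simp_all
          from rc sub(2) have "r' \<in> rverts h" "c' \<in> cverts h" by auto
          then have "r' \<in> \<phi> ` rverts g" "c' \<in> \<phi> ` cverts g"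
            unfolding bij_betw_imp_surj_on[OF br] bij_betw_imp_surj_on[OF bc] .
          then obtain r c where *: "r \<in> rverts g" "c \<in> cverts g" "r' = \<phi> r" "c' = \<phi> c"
            by (elim imageE)
          with rc e[of r c] have "(r, c) \<in> edges g" by (simp add: \<phi>r \<phi>c)
          moreover have "r = v \<or> c = v"
            using inc inj_onD[OF inj, of r v] inj_onD[OF inj, of c v] *(1,2) v
            unfolding *(3,4) by blast
          ultimately have "(r, c) \<in> {e \<in> edges g. fst e = v \<or> snd e = v}" by simp
          moreover have "x = map_prod \<phi> \<phi> (r, c)" by (simp only: x *(3,4) map_prod_simp)
          ultimately show "x \<in> ?L" by (rule rev_image_eqI)
        qed
      qed
    qed
    then show ?thesis
      unfolding vertex_degree_def by (rule bij_betw_same_card[symmetric])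
  qed
  have "\<phi> ` {v \<in> rverts g \<union> cverts g. vertex_degree g v = i} =
          {v \<in> rverts h \<union> cverts h. vertex_degree h v = i}"
  proof -
    have "\<phi> ` (rverts g \<union> cverts g) = rverts h \<union> cverts h"
      using bij by (simp only: bij_betw_def)
    then have "{v \<in> rverts h \<union> cverts h. vertex_degree h v = i} =
        {w \<in> \<phi> ` (rverts g \<union> cverts g). vertex_degree h w = i}"
      by (simp only:)
    also have "\<dots> = \<phi> ` {v \<in> rverts g \<union> cverts g. vertex_degree h (\<phi> v) = i}"
      by (rule Compr_image_eq)
    also have "{v \<in> rverts g \<union> cverts g. vertex_degree h (\<phi> v) = i} =
        {v \<in> rverts g \<union> cverts g. vertex_degree g v = i}"
      by (intro Collect_cong conj_cong refl) (simp only: deg)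
    finally show ?thesis by (rule sym)
  qed
  moreover have "inj_on \<phi> {v \<in> rverts g \<union> cverts g. vertex_degree g v = i}"
    by (rule inj_on_subset[OF inj]) (rule Collect_restrict)
  ultimately have "bij_betw \<phi> {v \<in> rverts g \<union> cverts g. vertex_degree g v = i}
      {v \<in> rverts h \<union> cverts h. vertex_degree h v = i}"
    unfolding bij_betw_def by (intro conjI)
  then show ?thesis
    unfolding psi_def by (rule bij_betw_same_card)
qed

lemma psi_class_eq:
  assumes "\<gamma> \<in> bgraph_classes n k" and "g \<in> \<gamma>"
  shows "psi_class i \<gamma> = psi i g"
proof -
  have "psi i h = psi i g" if "h \<in> \<gamma>" for h
  proof -
    have "(h, g) \<in> bgraph_iso_rel n k"
      by (rule in_quotient_imp_in_rel[OF equiv_bgraph_iso_rel, of \<gamma>])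
        (use assms that in \<open>simp_all add: bgraph_classes_def\<close>)
    then have "h \<in> bgraphs n k" "g \<in> bgraphs n k" "bgraph_iso h g"
      by (simp_all add: bgraph_iso_rel_def)
    then show ?thesis by (rule psi_bgraph_iso)
  qed
  then have "psi i ` \<gamma> = (\<lambda>_. psi i g) ` \<gamma>" by (rule image_cong[OF refl])
  also have "\<dots> = {psi i g}" using assms(2) by (rule image_constant)
  finally have "psi i ` \<gamma> = {psi i g}" .
  then show ?thesis by (simp add: psi_class_def)
qed

end

theory Submission
  imports Defs "HOL-Combinatorics.Permutations"
begin

text \<open>
  In the block in block row \<open>k\<close> and block column \<open>l\<close>, an S-permutation matrix has its only 1 at
  some position \<open>(p k l, q l k)\<close>. The row condition says that each \<open>p k\<close> is a permutation, the
  column condition that each \<open>q l\<close> is, and there is no further constraint. Disjointness from the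
  matrix of \<open>(a, b)\<close> forbids \<open>(p k l, q l k) = (a k l, b l k)\<close> for every \<open>(k, l)\<close>; inclusion-exclusion
  over the set \<open>S\<close> of block positions where both agree gives
  \<open>\<Sum>\<^sub>S (-1)\<^bsup>|S|\<^esup> \<Prod>\<^sub>v (n - deg v)!\<close>, with \<open>S\<close> read as the edge set of a bipartite graph and \<open>v\<close> ranging
  over its \<open>2n\<close> vertices. Vertices of degree \<open>n - 1\<close> and \<open>n\<close> contribute the factor 1.
\<close>

declare One_nat_def [simp del]

section \<open>S-permutation matrices as pairs of families of permutations\<close>

lemma block_index_less:
  fixes k i n :: nat
  assumes "k < n" and "i < n"
  shows "k * n + i < n\<^sup>2"
proof -
  have "k * n + i < Suc k * n" using assms(2) by simp
  also have "\<dots> \<le> n * n" using assms(1) by (intro mult_le_mono1) simp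
  finally show ?thesis by (simp add: power2_eq_square)
qed

lemma div_less_of_less_square:
  fixes r n :: nat
  assumes "r < n\<^sup>2"
  shows "r div n < n"
  using assms by (simp add: power2_eq_square less_mult_imp_div_less)

text \<open>Division by \<open>n\<close> gives the block of an index and \<open>mod\<close> the
  offset inside it. The second family takes the block column first, so that \<open>p k\<close> and
  \<open>q l\<close> are the maps on which the row and column conditions act.\<close>

definition block_perm_mat :: "nat \<Rightarrow> (nat \<Rightarrow> nat \<Rightarrow> nat) \<Rightarrow> (nat \<Rightarrow> nat \<Rightarrow> nat) \<Rightarrow> nat mat" where
  "block_perm_mat n p q = mat (n\<^sup>2) (n\<^sup>2)
     (\<lambda>(r, c). if p (r div n) (c div n) = r mod n \<and> q (c div n) (r div n) = c mod n then 1 else 0)"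

text \<open>The extensional function space fixes the values at indices outside the range, so a
  family is determined by finitely many permutations and families can be counted by a
  product.\<close>

definition perm_families :: "nat \<Rightarrow> (nat \<Rightarrow> nat \<Rightarrow> nat) set" where
  "perm_families n = ({..<n} \<rightarrow>\<^sub>E {p. p permutes {..<n}})"

lemma perm_familiesD: "p \<in> perm_families n \<Longrightarrow> k < n \<Longrightarrow> p k permutes {..<n}"
  by (auto simp: perm_families_def)

lemma perm_families_less: "p \<in> perm_families n \<Longrightarrow> k < n \<Longrightarrow> l < n \<Longrightarrow> p k l < n"
  using perm_familiesD[THEN permutes_in_image, of p n k l] by simp

text \<open>All other values are forced: both families are \<open>undefined\<close> at indices
  \<open>k \<ge> n\<close>, and a permutation of \<open>{..<n}\<close> fixes every
  \<open>l \<ge> n\<close>.\<close>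

lemma perm_families_eqI:
  assumes "p \<in> perm_families n" "p' \<in> perm_families n"
    and "\<And>k l. k < n \<Longrightarrow> l < n \<Longrightarrow> p k l = p' k l"
  shows "p = p'"
proof (rule PiE_ext)
  show "p \<in> {..<n} \<rightarrow>\<^sub>E {p. p permutes {..<n}}" "p' \<in> {..<n} \<rightarrow>\<^sub>E {p. p permutes {..<n}}"
    using assms(1,2) by (simp_all add: perm_families_def)
  show "p k = p' k" if "k \<in> {..<n}" for k
  proof
    fix l
    show "p k l = p' k l"
      using that assms(3)[of k l] permutes_not_in[OF perm_familiesD[OF assms(1)], of k l]
        permutes_not_in[OF perm_familiesD[OF assms(2)], of k l]
      by (cases "l < n") auto
  qed
qed

lemma finite_perm_families: "finite (perm_families n)"
  unfolding perm_families_def by (intro finite_PiE finite_permutations finite_lessThan)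

lemma dim_block_perm_mat [simp]:
  "dim_row (block_perm_mat n p q) = n\<^sup>2" "dim_col (block_perm_mat n p q) = n\<^sup>2"
  by (simp_all add: block_perm_mat_def)

lemma index_block_perm_mat:
  assumes "r < n\<^sup>2" and "c < n\<^sup>2"
  shows "block_perm_mat n p q $$ (r, c) = 1 \<longleftrightarrow>
    p (r div n) (c div n) = r mod n \<and> q (c div n) (r div n) = c mod n"
  using assms by (simp add: block_perm_mat_def)

lemma index_block_perm_mat_block:
  assumes "k < n" "l < n" "i < n" "j < n"
  shows "block_perm_mat n p q $$ (k * n + i, l * n + j) = 1 \<longleftrightarrow> p k l = i \<and> q l k = j"
  using assms by (simp add: index_block_perm_mat block_index_less)

text \<open>For a row in block row \<open>k\<close> with offset \<open>i\<close>, bijectivity of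
  \<open>p k\<close> selects exactly one block column \<open>l\<close> with
  \<open>p k l = i\<close>, and \<open>q l k\<close> then fixes the column inside that block.
  Columns are dual, and a block has its 1 only at \<open>(p k l, q l k)\<close>.\<close>

lemma block_perm_mat_in:
  assumes p: "p \<in> perm_families n" and q: "q \<in> perm_families n"
  shows "block_perm_mat n p q \<in> S_permutation_mats n"
  unfolding S_permutation_mats_def
proof (intro CollectI conjI allI impI)
  let ?B = "block_perm_mat n p q"
  show "?B \<in> carrier_mat (n\<^sup>2) (n\<^sup>2)" by (simp add: block_perm_mat_def)
  show "binary_mat ?B"
    by (auto simp: binary_mat_def elements_mat_def block_perm_mat_def)
  fix r assume r: "r < n\<^sup>2"
  have n: "n > 0" using r by (cases n) auto
  have k: "r div n < n" and i: "r mod n < n"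
    using r n by (simp_all add: div_less_of_less_square)
  obtain l where l: "p (r div n) l = r mod n" "l < n"
    using permutes_image[OF perm_familiesD[OF p k]] i by (metis imageE lessThan_iff)
  have inj: "l' = l" if "p (r div n) l' = r mod n" for l'
    by (rule injD[OF permutes_inj[OF perm_familiesD[OF p k]]]) (simp add: that l(1))
  have j: "q l (r div n) < n" by (rule perm_families_less[OF q l(2) k])
  show "\<exists>!c. c < n\<^sup>2 \<and> ?B $$ (r, c) = 1"
  proof (rule ex1I)
    show "l * n + q l (r div n) < n\<^sup>2 \<and> ?B $$ (r, l * n + q l (r div n)) = 1"
      using l j r by (simp add: index_block_perm_mat block_index_less)
    show "c = l * n + q l (r div n)" if "c < n\<^sup>2 \<and> ?B $$ (r, c) = 1" for c
      using that r inj[of "c div n"] div_mult_mod_eq[of c n] by (auto simp: index_block_perm_mat)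
  qed
next
  let ?B = "block_perm_mat n p q"
  fix c assume c: "c < n\<^sup>2"
  have n: "n > 0" using c by (cases n) auto
  have l: "c div n < n" and j: "c mod n < n"
    using c n by (simp_all add: div_less_of_less_square)
  obtain k where k: "q (c div n) k = c mod n" "k < n"
    using permutes_image[OF perm_familiesD[OF q l]] j by (metis imageE lessThan_iff)
  have inj: "k' = k" if "q (c div n) k' = c mod n" for k'
    by (rule injD[OF permutes_inj[OF perm_familiesD[OF q l]]]) (simp add: that k(1))
  have i: "p k (c div n) < n" by (rule perm_families_less[OF p k(2) l])
  show "\<exists>!r. r < n\<^sup>2 \<and> ?B $$ (r, c) = 1"
  proof (rule ex1I)
    show "k * n + p k (c div n) < n\<^sup>2 \<and> ?B $$ (k * n + p k (c div n), c) = 1"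
      using k i c by (simp add: index_block_perm_mat block_index_less)
    show "r = k * n + p k (c div n)" if "r < n\<^sup>2 \<and> ?B $$ (r, c) = 1" for r
      using that c inj[of "r div n"] div_mult_mod_eq[of r n] by (auto simp: index_block_perm_mat)
  qed
next
  let ?B = "block_perm_mat n p q"
  fix k l assume kl: "k < n" "l < n"
  show "\<exists>!x. x \<in> {..<n} \<times> {..<n} \<and> block n ?B k l $$ x = 1"
    by (rule ex1I[of _ "(p k l, q l k)"])
      (use kl perm_families_less[OF p] perm_families_less[OF q] in
        \<open>auto simp: block_def index_block_perm_mat_block\<close>)
qed

text \<open>Surjectivity of the encoding: the positions of the 1s, block by block, are split into
  row offsets and column offsets, and uniqueness in rows and columns makes these offsets
  injective.\<close>

lemma S_permutation_mat_obtain: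
  assumes A: "A \<in> S_permutation_mats n"
  obtains p q where "p \<in> perm_families n" "q \<in> perm_families n" "A = block_perm_mat n p q"
proof -
  have car: "A \<in> carrier_mat (n\<^sup>2) (n\<^sup>2)" and bin: "elements_mat A \<subseteq> {0, 1}"
    and row: "\<And>r. r < n\<^sup>2 \<Longrightarrow> \<exists>!c. c < n\<^sup>2 \<and> A $$ (r, c) = 1"
    and col: "\<And>c. c < n\<^sup>2 \<Longrightarrow> \<exists>!r. r < n\<^sup>2 \<and> A $$ (r, c) = 1"
    and blk: "\<And>k l. k < n \<Longrightarrow> l < n \<Longrightarrow>
      \<exists>!x. x \<in> {..<n} \<times> {..<n} \<and> block n A k l $$ x = 1"
    using A by (auto simp: S_permutation_mats_def binary_mat_def)
  define pos where "pos k l = (THE x. x \<in> {..<n} \<times> {..<n} \<and> block n A k l $$ x = 1)" for k l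
  have pos_less: "fst (pos k l) < n" "snd (pos k l) < n"
    and pos_entry: "A $$ (k * n + fst (pos k l), l * n + snd (pos k l)) = 1"
    if "k < n" "l < n" for k l
  proof -
    have "pos k l \<in> {..<n} \<times> {..<n} \<and> block n A k l $$ pos k l = 1"
      unfolding pos_def by (rule theI'[OF blk[OF that]])
    then show "fst (pos k l) < n" "snd (pos k l) < n"
      "A $$ (k * n + fst (pos k l), l * n + snd (pos k l)) = 1"
      by (auto simp: block_def)
  qed
  have pos_unique: "pos k l = (i, j)"
    if "k < n" "l < n" "i < n" "j < n" "A $$ (k * n + i, l * n + j) = 1" for k l i j
    unfolding pos_def
    by (rule the1_equality[OF blk[OF that(1,2)]]) (use that in \<open>simp add: block_def\<close>)
  \<comment> \<open>Two defaults are at work: \<open>undefined\<close> at block rows outside the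
    range, for extensionality, and the identity at \<open>l \<ge> n\<close>, as
    \<open>permutes\<close> demands.\<close>
  define p where "p = (\<lambda>k\<in>{..<n}. \<lambda>l. if l < n then fst (pos k l) else l)"
  define q where "q = (\<lambda>l\<in>{..<n}. \<lambda>k. if k < n then snd (pos k l) else k)"
  have div_eq: "l = l'" if "l * n + j = l' * n + j'" "j < n" "j' < n" for l l' j j' :: nat
    using arg_cong[OF that(1), of "\<lambda>x. x div n"] that(2,3) by simp
  have p: "p \<in> perm_families n"
    unfolding perm_families_def
  proof (rule PiE_I, rule CollectI)
    fix k assume k: "k \<in> {..<n}"
    show "p k permutes {..<n}"
    proof (rule inj_imp_permutes)
      show "inj_on (p k) {..<n}"
      proof (rule inj_onI)
        fix l l' assume l: "l \<in> {..<n}" "l' \<in> {..<n}" and "p k l = p k l'"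
        with k have eq: "fst (pos k l) = fst (pos k l')" by (simp add: p_def)
        \<comment> \<open>Equal row offsets in two blocks of one block row put both 1s into the same
          matrix row, so their columns coincide; division by \<open>n\<close> then identifies the
          block columns. Injectivity is enough because \<open>{..<n}\<close> is finite.\<close>
        have "l * n + snd (pos k l) = l' * n + snd (pos k l')"
          using row[of "k * n + fst (pos k l)"] pos_entry[of k l] pos_entry[of k l'] k l eq
            block_index_less[of k n "fst (pos k l)"] block_index_less[of l n "snd (pos k l)"]
            block_index_less[of l' n "snd (pos k l')"] pos_less[of k l] pos_less[of k l']
          by auto
        then show "l = l'" by (rule div_eq) (use k l pos_less in auto)
      qed
    qed (use k pos_less in \<open>auto simp: p_def\<close>)
  qed (simp add: p_def)
  have q: "q \<in> perm_families n"
    unfolding perm_families_def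
  proof (rule PiE_I, rule CollectI)
    fix l assume l: "l \<in> {..<n}"
    show "q l permutes {..<n}"
    proof (rule inj_imp_permutes)
      show "inj_on (q l) {..<n}"
      proof (rule inj_onI)
        fix k k' assume k: "k \<in> {..<n}" "k' \<in> {..<n}" and "q l k = q l k'"
        with l have eq: "snd (pos k l) = snd (pos k' l)" by (simp add: q_def)
        have "k * n + fst (pos k l) = k' * n + fst (pos k' l)"
          using col[of "l * n + snd (pos k l)"] pos_entry[of k l] pos_entry[of k' l] k l eq
            block_index_less[of l n "snd (pos k l)"] block_index_less[of k n "fst (pos k l)"]
            block_index_less[of k' n "fst (pos k' l)"] pos_less[of k l] pos_less[of k' l]
          by auto
        then show "k = k'" by (rule div_eq) (use k l pos_less in auto)
      qed
    qed (use l pos_less in \<open>auto simp: q_def\<close>)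
  qed (simp add: q_def)
  have "A = block_perm_mat n p q"
  proof (rule eq_matI)
    fix r c assume "r < dim_row (block_perm_mat n p q)" "c < dim_col (block_perm_mat n p q)"
    then have rc: "r < n\<^sup>2" "c < n\<^sup>2" by (simp_all add: block_perm_mat_def)
    then have n: "n > 0" by (cases n) auto
    have k: "r div n < n" "c div n < n" using rc by (simp_all add: div_less_of_less_square)
    \<comment> \<open>Both matrices are binary, so it suffices to compare where their entries equal
      1.\<close>
    have "A $$ (r, c) \<in> {0, 1}"
      by (rule subsetD[OF bin]) (use car rc in auto)
    moreover have "A $$ (r, c) = 1 \<longleftrightarrow> pos (r div n) (c div n) = (r mod n, c mod n)"
      using pos_entry[OF k] pos_unique[OF k, of "r mod n" "c mod n"] n by auto
    moreover have "block_perm_mat n p q $$ (r, c) =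
        (if pos (r div n) (c div n) = (r mod n, c mod n) then 1 else 0)"
      using rc k by (auto simp: block_perm_mat_def p_def q_def prod_eq_iff)
    ultimately show "A $$ (r, c) = block_perm_mat n p q $$ (r, c)" by auto
  qed (use car in \<open>simp_all add: block_perm_mat_def\<close>)
  with p q that show ?thesis by blast
qed

lemma bij_betw_block_perm_mat:
  "bij_betw (\<lambda>(p, q). block_perm_mat n p q) (perm_families n \<times> perm_families n)
    (S_permutation_mats n)"
  unfolding bij_betw_def
proof
  show "inj_on (\<lambda>(p, q). block_perm_mat n p q) (perm_families n \<times> perm_families n)"
  proof (rule inj_onI, clarify)
    fix p q p' q'
    assume mem: "p \<in> perm_families n" "q \<in> perm_families n"
        "p' \<in> perm_families n" "q' \<in> perm_families n"
      and eq: "block_perm_mat n p q = block_perm_mat n p' q'"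
    have "p k l = p' k l \<and> q l k = q' l k" if kl: "k < n" "l < n" for k l
      using index_block_perm_mat_block[OF kl, of "p k l" "q l k" p q]
        index_block_perm_mat_block[OF kl, of "p k l" "q l k" p' q']
        mem kl eq by (simp add: perm_families_less)
    then show "p = p' \<and> q = q'" using mem by (auto intro!: perm_families_eqI)
  qed
  show "(\<lambda>(p, q). block_perm_mat n p q) ` (perm_families n \<times> perm_families n) =
      S_permutation_mats n"
  proof
    show "S_permutation_mats n \<subseteq>
        (\<lambda>(p, q). block_perm_mat n p q) ` (perm_families n \<times> perm_families n)"
    proof
      fix B assume "B \<in> S_permutation_mats n"
      then obtain p q where "p \<in> perm_families n" "q \<in> perm_families n" "B = block_perm_mat n p q"
        by (rule S_permutation_mat_obtain)
      then show "B \<in> (\<lambda>(p, q). block_perm_mat n p q) ` (perm_families n \<times> perm_families n)"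
        by auto
    qed
  qed (auto intro: block_perm_mat_in)
qed

text \<open>A common 1 lies in some block, where each matrix has no other 1, so the two positions in
  that block coincide; conversely, coinciding positions give a common 1.\<close>

lemma disjoint_block_perm_mat:
  assumes "a \<in> perm_families n" "b \<in> perm_families n" "p \<in> perm_families n" "q \<in> perm_families n"
  shows "disjoint_mats (block_perm_mat n a b) (block_perm_mat n p q) \<longleftrightarrow>
    (\<forall>k<n. \<forall>l<n. \<not> (p k l = a k l \<and> q l k = b l k))"
proof
  assume L: "disjoint_mats (block_perm_mat n a b) (block_perm_mat n p q)"
  show "\<forall>k<n. \<forall>l<n. \<not> (p k l = a k l \<and> q l k = b l k)"
  proof (intro allI impI notI)
    fix k l assume kl: "k < n" "l < n" and eq: "p k l = a k l \<and> q l k = b l k"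
    have "a k l < n" "b l k < n" using kl by (simp_all add: perm_families_less[OF assms(1)] perm_families_less[OF assms(2)])
    then have "k * n + a k l < n\<^sup>2" "l * n + b l k < n\<^sup>2"
      "block_perm_mat n a b $$ (k * n + a k l, l * n + b l k) = 1"
      "block_perm_mat n p q $$ (k * n + a k l, l * n + b l k) = 1"
      using kl eq by (simp_all add: block_index_less index_block_perm_mat_block)
    with L show False unfolding disjoint_mats_def dim_block_perm_mat by blast
  qed
next
  assume R: "\<forall>k<n. \<forall>l<n. \<not> (p k l = a k l \<and> q l k = b l k)"
  have "\<not> (block_perm_mat n a b $$ (r, c) = 1 \<and> block_perm_mat n p q $$ (r, c) = 1)"
    if "r < n\<^sup>2" "c < n\<^sup>2" for r c
    using R[rule_format, OF div_less_of_less_square[OF that(1)] div_less_of_less_square[OF that(2)]] that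
    by (auto simp: index_block_perm_mat)
  then show "disjoint_mats (block_perm_mat n a b) (block_perm_mat n p q)"
    by (auto simp: disjoint_mats_def)
qed

section \<open>Families with prescribed values, and inclusion-exclusion\<close>

lemma card_permutes_agreeing:
  assumes fin: "finite I" and a: "a permutes I" and T: "T \<subseteq> I"
  shows "card {p. p permutes I \<and> (\<forall>x\<in>T. p x = a x)} = fact (card I - card T)"
proof -
  \<comment> \<open>Agreement of \<open>p\<close> with \<open>a\<close> on \<open>T\<close> means
    that the inverse of \<open>a\<close> composed with \<open>p\<close> fixes \<open>T\<close>
    pointwise, hence permutes \<open>I - T\<close>.\<close>
  have "{p. p permutes I \<and> (\<forall>x\<in>T. p x = a x)} = (\<circ>) a ` {s. s permutes (I - T)}" (is "?L = ?R")
  proof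
    show "?L \<subseteq> ?R"
    proof
      fix p assume "p \<in> ?L"
      then have p: "p permutes I" "\<And>x. x \<in> T \<Longrightarrow> p x = a x" by auto
      have "inv_into UNIV a \<circ> p permutes I" by (rule permutes_compose[OF p(1) permutes_inv[OF a]])
      moreover have "(inv_into UNIV a \<circ> p) x = x" if "x \<in> I - (I - T)" for x
        using that p(2) permutes_inverses(2)[OF a] by auto
      ultimately have "inv_into UNIV a \<circ> p permutes (I - T)" by (rule permutes_superset)
      moreover have "p = a \<circ> (inv_into UNIV a \<circ> p)" using permutes_inverses(1)[OF a] by auto
      ultimately show "p \<in> ?R" by blast
    qed
    show "?R \<subseteq> ?L"
      using a by (auto intro!: permutes_compose intro: permutes_subset simp: permutes_not_in)
  qed
  moreover have "inj_on ((\<circ>) a) {s. s permutes (I - T)}"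
    using permutes_inj[OF a] by (auto intro!: inj_onI simp: fun.inj_map_strong fun_eq_iff inj_eq)
  ultimately have "card {p. p permutes I \<and> (\<forall>x\<in>T. p x = a x)} = card {s. s permutes (I - T)}"
    by (simp add: card_image)
  also have "\<dots> = fact (card (I - T))" by (rule card_permutations) (use fin in auto)
  also have "card (I - T) = card I - card T"
    by (rule card_Diff_subset) (use fin T finite_subset in auto)
  finally show ?thesis .
qed

text \<open>The vertex product of the formula, with degrees written as sizes of the row and column
  sections of \<open>S\<close>, so that the counting can proceed without graphs.\<close>

definition weight :: "nat \<Rightarrow> (nat \<times> nat) set \<Rightarrow> nat" where
  "weight n S = (\<Prod>k<n. fact (n - card {l. (k, l) \<in> S})) * (\<Prod>l<n. fact (n - card {k. (k, l) \<in> S}))"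

text \<open>The components of a family are chosen independently, so the counts multiply. The sets
  \<open>T k\<close> are arbitrary because both the row and the column sections of \<open>S\<close>
  are needed.\<close>

lemma card_perm_families_agreeing:
  assumes a: "a \<in> perm_families n" and T: "\<And>k. k < n \<Longrightarrow> T k \<subseteq> {..<n}"
  shows "card {p \<in> perm_families n. \<forall>k<n. \<forall>l\<in>T k. p k l = a k l} = (\<Prod>k<n. fact (n - card (T k)))"
proof -
  have "{p \<in> perm_families n. \<forall>k<n. \<forall>l\<in>T k. p k l = a k l} =
      (\<Pi>\<^sub>E k\<in>{..<n}. {p. p permutes {..<n} \<and> (\<forall>l\<in>T k. p l = a k l)})"
    by (auto simp: perm_families_def PiE_iff extensional_def)
  then have "card {p \<in> perm_families n. \<forall>k<n. \<forall>l\<in>T k. p k l = a k l} =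
      (\<Prod>k<n. card {p. p permutes {..<n} \<and> (\<forall>l\<in>T k. p l = a k l)})"
    by (simp add: card_PiE)
  also have "\<dots> = (\<Prod>k<n. fact (n - card (T k)))"
    by (rule prod.cong) (use perm_familiesD[OF a] T in \<open>simp_all add: card_permutes_agreeing\<close>)
  finally show ?thesis .
qed

text \<open>A pair \<open>(k, l)\<close> in \<open>S\<close> constrains \<open>p k\<close> at
  \<open>l\<close> and \<open>q l\<close> at \<open>k\<close> separately, so the set is a Cartesian
  product, with the sections for \<open>q\<close> taken along the other coordinate.\<close>

lemma card_agreeing:
  assumes a: "a \<in> perm_families n" and b: "b \<in> perm_families n" and S: "S \<subseteq> {..<n} \<times> {..<n}"
  shows "card {(p, q) \<in> perm_families n \<times> perm_families n.
    \<forall>(k, l)\<in>S. p k l = a k l \<and> q l k = b l k} = weight n S"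
proof -
  have "{(p, q) \<in> perm_families n \<times> perm_families n. \<forall>(k, l)\<in>S. p k l = a k l \<and> q l k = b l k} =
    {p \<in> perm_families n. \<forall>k<n. \<forall>l\<in>{l. (k, l) \<in> S}. p k l = a k l} \<times>
    {q \<in> perm_families n. \<forall>l<n. \<forall>k\<in>{k. (k, l) \<in> S}. q l k = b l k}"
    using S by auto
  also have "card \<dots> = weight n S"
    unfolding weight_def card_cartesian_product
    by (intro arg_cong2[of _ _ _ _ "(*)"] card_perm_families_agreeing a b) (use S in auto)
  finally show ?thesis .
qed

text \<open>Inclusion-exclusion: the indicator of avoiding every property is a product of factors 1
  minus an indicator; it is multiplied out over the subsets of \<open>U\<close>, and the two sums
  are interchanged.\<close>

lemma card_avoiding_all:
  fixes R :: "'a \<Rightarrow> 'b \<Rightarrow> bool"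
  assumes X: "finite X" and U: "finite U"
  shows "int (card {x \<in> X. \<forall>u\<in>U. \<not> R u x}) =
    (\<Sum>S\<in>Pow U. (- 1) ^ card S * int (card {x \<in> X. \<forall>u\<in>S. R u x}))"
proof -
  have ind: "(\<Prod>u\<in>S. if P u then 1 else 0) = (if \<forall>u\<in>S. P u then 1 else (0 :: int))"
    if "S \<subseteq> U" for P and S :: "'a set"
    using finite_subset[OF that U] by (induction S rule: finite_induct) auto
  have count: "int (card {x \<in> X. Q x}) = (\<Sum>x\<in>X. if Q x then 1 else 0)" for Q
    using X by (simp add: sum.If_cases Int_def)
  have "int (card {x \<in> X. \<forall>u\<in>U. \<not> R u x}) = (\<Sum>x\<in>X. \<Prod>u\<in>U. if \<not> R u x then 1 else 0)"
    unfolding count by (simp only: ind[OF order_refl])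
  also have "\<dots> = (\<Sum>x\<in>X. \<Prod>u\<in>U. 1 - (if R u x then 1 else 0))"
    by (intro sum.cong prod.cong) auto
  also have "\<dots> = (\<Sum>x\<in>X. \<Sum>S\<in>Pow U. (- 1) ^ card S * (if \<forall>u\<in>S. R u x then 1 else 0))"
    by (intro sum.cong refl) (simp add: prod_diff_conv_sum[OF U] ind)
  also have "\<dots> = (\<Sum>S\<in>Pow U. \<Sum>x\<in>X. (- 1) ^ card S * (if \<forall>u\<in>S. R u x then 1 else 0))"
    by (rule sum.swap)
  also have "\<dots> = (\<Sum>S\<in>Pow U. (- 1) ^ card S * int (card {x \<in> X. \<forall>u\<in>S. R u x}))"
    unfolding count by (simp only: sum_distrib_left)
  finally show ?thesis .
qed

text \<open>The matrix \<open>A\<close> enters only through the values to be agreed with, and the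
  number of agreeing pairs depends on \<open>S\<close> alone.\<close>

lemma card_disjoint_S_permutation_mats:
  assumes "A \<in> S_permutation_mats n"
  shows "int (card {B \<in> S_permutation_mats n. disjoint_mats A B}) =
    (\<Sum>S\<in>Pow ({..<n} \<times> {..<n}). (- 1) ^ card S * int (weight n S))"
proof -
  obtain a b where ab: "a \<in> perm_families n" "b \<in> perm_families n" and A: "A = block_perm_mat n a b"
    using assms by (rule S_permutation_mat_obtain)
  let ?X = "perm_families n \<times> perm_families n" and ?U = "{..<n} \<times> {..<n}"
  \<comment> \<open>Here \<open>u\<close> is a block and \<open>x\<close> a coded matrix; the
    property is that \<open>x\<close> and \<open>A\<close> have their 1 of block \<open>u\<close> at
    the same position.\<close>
  define R where "R u x \<longleftrightarrow> fst x (fst u) (snd u) = a (fst u) (snd u) \<and>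
      snd x (snd u) (fst u) = b (snd u) (fst u)" for u :: "nat \<times> nat" and x
  let ?f = "\<lambda>(p, q). block_perm_mat n p q"
  have "{B \<in> S_permutation_mats n. disjoint_mats A B} = {B \<in> ?f ` ?X. disjoint_mats A B}"
    by (simp only: bij_betw_imp_surj_on[OF bij_betw_block_perm_mat])
  also have "\<dots> = ?f ` {x \<in> ?X. disjoint_mats A (?f x)}"
    by (rule Compr_image_eq)
  also have "{x \<in> ?X. disjoint_mats A (?f x)} = {x \<in> ?X. \<forall>u\<in>?U. \<not> R u x}"
  proof (rule Collect_cong, rule conj_cong[OF refl])
    fix x assume "x \<in> ?X"
    then show "disjoint_mats A (?f x) \<longleftrightarrow> (\<forall>u\<in>?U. \<not> R u x)"
      by (cases x) (simp add: A disjoint_block_perm_mat ab R_def Ball_def split_paired_All, blast)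
  qed
  finally have "{B \<in> S_permutation_mats n. disjoint_mats A B} =
      ?f ` {x \<in> ?X. \<forall>u\<in>?U. \<not> R u x}" .
  moreover have "inj_on ?f {x \<in> ?X. \<forall>u\<in>?U. \<not> R u x}"
    by (rule inj_on_subset[OF bij_betw_imp_inj_on[OF bij_betw_block_perm_mat]]) simp
  ultimately have "int (card {B \<in> S_permutation_mats n. disjoint_mats A B}) =
      int (card {x \<in> ?X. \<forall>u\<in>?U. \<not> R u x})"
    by (simp only: card_image)
  also have "\<dots> = (\<Sum>S\<in>Pow ?U. (- 1) ^ card S * int (card {x \<in> ?X. \<forall>u\<in>S. R u x}))"
    by (rule card_avoiding_all) (simp_all add: finite_perm_families)
  also have "\<dots> = (\<Sum>S\<in>Pow ?U. (- 1) ^ card S * int (weight n S))"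
  proof (rule sum.cong[OF refl])
    fix S assume "S \<in> Pow ?U"
    then have "card {(p, q) \<in> ?X. \<forall>(k, l)\<in>S. p k l = a k l \<and> q l k = b l k} = weight n S"
      by (intro card_agreeing ab) auto
    moreover have "{(p, q) \<in> ?X. \<forall>(k, l)\<in>S. p k l = a k l \<and> q l k = b l k} = {x \<in> ?X. \<forall>u\<in>S. R u x}"
      by (auto simp: R_def split: prod.splits)
    ultimately show "(- 1) ^ card S * int (card {x \<in> ?X. \<forall>u\<in>S. R u x}) = (- 1) ^ card S * int (weight n S)"
      by simp
  qed
  finally show ?thesis .
qed

section \<open>Bipartite graphs and their isomorphism classes\<close>

definition graph_of :: "nat \<Rightarrow> (nat \<times> nat) set \<Rightarrow> bgraph" where
  "graph_of n S = \<lparr>rverts = Row ` {1..n}, cverts = Col ` {1..n},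
     edges = (\<lambda>(k, l). (Row (Suc k), Col (Suc l))) ` S\<rparr>"

lemma inj_edge: "inj (\<lambda>(k, l). (Row (Suc k), Col (Suc l)))"
  by (auto intro: injI)

text \<open>With the vertex sets fixed, a graph is nothing but its edge set.\<close>

lemma bij_betw_graph_of:
  "bij_betw (graph_of n) {S \<in> Pow ({..<n} \<times> {..<n}). card S = k} (bgraphs n k)"
  unfolding bij_betw_def
proof
  show "inj_on (graph_of n) {S \<in> Pow ({..<n} \<times> {..<n}). card S = k}"
    by (rule inj_onI) (simp add: graph_of_def inj_image_eq_iff[OF inj_edge])
  \<comment> \<open>Blocks are numbered from 0 and vertices from 1, hence the shift by
    \<open>Suc\<close>.\<close>
  have verts: "f ` {1..n} = (\<lambda>i. f (Suc i)) ` {..<n}" for f :: "nat \<Rightarrow> vertex"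
    by (simp add: image_Suc_lessThan[symmetric] image_image)
  have prod: "Row ` {1..n} \<times> Col ` {1..n} =
      (\<lambda>(k, l). (Row (Suc k), Col (Suc l))) ` ({..<n} \<times> {..<n})"
    unfolding verts by auto
  show "graph_of n ` {S \<in> Pow ({..<n} \<times> {..<n}). card S = k} = bgraphs n k"
  proof
    show "graph_of n ` {S \<in> Pow ({..<n} \<times> {..<n}). card S = k} \<subseteq> bgraphs n k"
    proof (rule image_subsetI)
      fix S assume S: "S \<in> {S \<in> Pow ({..<n} \<times> {..<n}). card S = k}"
      then have "(\<lambda>(k, l). (Row (Suc k), Col (Suc l))) ` S \<subseteq> Row ` {1..n} \<times> Col ` {1..n}"
        unfolding prod by (intro image_mono) simp
      then show "graph_of n S \<in> bgraphs n k"
        using S by (simp add: bgraphs_def graph_of_def card_image inj_on_subset[OF inj_edge])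
    qed
    show "bgraphs n k \<subseteq> graph_of n ` {S \<in> Pow ({..<n} \<times> {..<n}). card S = k}"
    proof
      fix g assume "g \<in> bgraphs n k"
      then have g: "rverts g = Row ` {1..n}" "cverts g = Col ` {1..n}"
        "edges g \<subseteq> Row ` {1..n} \<times> Col ` {1..n}" "card (edges g) = k"
        by (auto simp: bgraphs_def)
      from g(3) obtain S where S: "S \<subseteq> {..<n} \<times> {..<n}"
        "edges g = (\<lambda>(k, l). (Row (Suc k), Col (Suc l))) ` S"
        unfolding prod by (rule subset_imageE)
      have "card S = k"
        using g(4) by (simp add: S(2) card_image inj_on_subset[OF inj_edge])
      moreover have "g = graph_of n S"
        by (rule bgraph.equality) (simp_all add: graph_of_def g(1,2) S(2))
      ultimately show "g \<in> graph_of n ` {S \<in> Pow ({..<n} \<times> {..<n}). card S = k}"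
        using S(1) by blast
    qed
  qed
qed

lemma degree_graph_of:
  "vertex_degree (graph_of n S) (Row (Suc k)) = card {l. (k, l) \<in> S}"
  "vertex_degree (graph_of n S) (Col (Suc l)) = card {k. (k, l) \<in> S}"
proof -
  have "{e \<in> edges (graph_of n S). fst e = Row (Suc k) \<or> snd e = Row (Suc k)} =
      (\<lambda>l. (Row (Suc k), Col (Suc l))) ` {l. (k, l) \<in> S}"
    by (auto simp: graph_of_def)
  then show "vertex_degree (graph_of n S) (Row (Suc k)) = card {l. (k, l) \<in> S}"
    by (simp add: vertex_degree_def card_image inj_on_def)
  have "{e \<in> edges (graph_of n S). fst e = Col (Suc l) \<or> snd e = Col (Suc l)} =
      (\<lambda>k. (Row (Suc k), Col (Suc l))) ` {k. (k, l) \<in> S}"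
    by (auto simp: graph_of_def)
  then show "vertex_degree (graph_of n S) (Col (Suc l)) = card {k. (k, l) \<in> S}"
    by (simp add: vertex_degree_def card_image inj_on_def)
qed

text \<open>Grouping the vertices by degree collects equal factors into powers with exponent
  \<open>psi i\<close>; the row vertices and the column vertices yield the two factors of
  \<open>weight\<close>.\<close>

lemma prod_psi_graph_of:
  assumes n: "n > 0" and S: "S \<subseteq> {..<n} \<times> {..<n}"
  shows "(\<Prod>i = 0..<n - 1. fact (n - i) ^ psi i (graph_of n S)) = weight n S"
proof -
  let ?g = "graph_of n S"
  let ?V = "rverts ?g \<union> cverts ?g"
  have V: "?V = (\<lambda>k. Row (Suc k)) ` {..<n} \<union> (\<lambda>k. Col (Suc k)) ` {..<n}"
    by (simp add: graph_of_def image_Suc_lessThan[symmetric] image_image)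
  have fin: "finite ?V" unfolding V by simp
  have "card {l. (k, l) \<in> S} \<le> n" "card {l. (l, k) \<in> S} \<le> n" for k
    using S by (auto intro!: card_mono[of "{..<n}", simplified])
  then have deg: "vertex_degree ?g ` ?V \<subseteq> {0..n}"
    unfolding V by (auto simp: degree_graph_of)
  \<comment> \<open>The half-open range ends at \<open>n - 2\<close> and is empty for
    \<open>n = 1\<close>. It is extended to all possible degrees, since 1! and 0! are 1.\<close>
  have "(\<Prod>i = 0..<n - 1. fact (n - i) ^ psi i ?g) = (\<Prod>i\<in>{0..n}. (fact (n - i) :: nat) ^ psi i ?g)"
  proof (rule prod.mono_neutral_left)
    show "\<forall>i\<in>{0..n} - {0..<n - 1}. (fact (n - i) :: nat) ^ psi i ?g = 1"
    proof
      fix i assume "i \<in> {0..n} - {0..<n - 1}"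
      then have "n - i = 0 \<or> n - i = 1" using n by auto
      then show "(fact (n - i) :: nat) ^ psi i ?g = 1" by auto
    qed
  qed auto
  also have "\<dots> = (\<Prod>i\<in>{0..n}. \<Prod>v\<in>{v. v \<in> ?V \<and> vertex_degree ?g v = i}. fact (n - vertex_degree ?g v))"
    by (rule prod.cong) (simp_all add: psi_def)
  also have "\<dots> = (\<Prod>v\<in>?V. fact (n - vertex_degree ?g v))"
    by (rule prod.group[OF fin _ deg]) simp
  also have "\<dots> = weight n S"
    unfolding V weight_def
    by (subst prod.union_disjoint) (auto simp: prod.reindex inj_on_def degree_graph_of)
  finally show ?thesis .
qed

text \<open>The classes partition the labelled graphs and \<open>f\<close> is constant on each of
  them, so a class contributes its size times the common value.\<close>

lemma sum_bgraph_classes: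
  fixes f :: "bgraph \<Rightarrow> int" and F :: "bgraph set \<Rightarrow> int"
  assumes F: "\<And>\<gamma> g. \<gamma> \<in> bgraph_classes n k \<Longrightarrow> g \<in> \<gamma> \<Longrightarrow> F \<gamma> = f g"
  shows "(\<Sum>\<gamma>\<in>bgraph_classes n k. int (card \<gamma>) * F \<gamma>) = (\<Sum>g\<in>bgraphs n k. f g)"
proof -
  have fin: "finite (bgraphs n k)"
    using bij_betw_finite[OF bij_betw_graph_of[of n k]] by simp
  have Un: "\<Union>(bgraph_classes n k) = bgraphs n k"
    unfolding bgraph_classes_def by (rule Union_quotient[OF equiv_bgraph_iso_rel])
  have "(\<Sum>g\<in>\<Union>(bgraph_classes n k). f g) = (\<Sum>\<gamma>\<in>bgraph_classes n k. \<Sum>g\<in>\<gamma>. f g)"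
  proof (subst sum.Union_disjoint)
    show "\<forall>\<gamma>\<in>bgraph_classes n k. finite \<gamma>"
      using Un fin by (metis Union_upper finite_subset)
    show "\<forall>\<gamma>\<in>bgraph_classes n k. \<forall>\<delta>\<in>bgraph_classes n k. \<gamma> \<noteq> \<delta> \<longrightarrow> \<gamma> \<inter> \<delta> = {}"
      using quotient_disj[OF equiv_bgraph_iso_rel] unfolding bgraph_classes_def by blast
  qed simp
  also have "\<dots> = (\<Sum>\<gamma>\<in>bgraph_classes n k. int (card \<gamma>) * F \<gamma>)"
    using F by (intro sum.cong refl) (simp flip: F)
  finally show ?thesis by (simp add: Un)
qed

section \<open>Assembly of the formula\<close>

theorem theorem2:
  fixes n :: nat and A :: "nat mat"
  assumes "n > 0"
    and "A \<in> S_permutation_mats n"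
  shows "int (card {B \<in> S_permutation_mats n. disjoint_mats A B}) =
    (fact n) ^ (2 * n) +
    (\<Sum>k = 1..n\<^sup>2. (- 1) ^ k *
      (\<Sum>\<gamma>\<in>bgraph_classes n k. int (card \<gamma>) * (\<Prod>i = 0..<n - 1. fact (n - i) ^ psi_class i \<gamma>)))"
proof -
  let ?P = "Pow ({..<n} \<times> {..<n})"
  define W where "W k = (\<Sum>S\<in>{S \<in> ?P. card S = k}. int (weight n S))" for k
  have W: "(\<Sum>\<gamma>\<in>bgraph_classes n k. int (card \<gamma>) * (\<Prod>i = 0..<n - 1. fact (n - i) ^ psi_class i \<gamma>)) = W k"
    for k
  proof -
    have "(\<Sum>\<gamma>\<in>bgraph_classes n k. int (card \<gamma>) * (\<Prod>i = 0..<n - 1. fact (n - i) ^ psi_class i \<gamma>)) =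
        (\<Sum>g\<in>bgraphs n k. \<Prod>i = 0..<n - 1. fact (n - i) ^ psi i g)"
      by (rule sum_bgraph_classes) (simp add: psi_class_eq)
    also have "\<dots> = (\<Sum>S\<in>{S \<in> ?P. card S = k}. \<Prod>i = 0..<n - 1. fact (n - i) ^ psi i (graph_of n S))"
      by (rule sum.reindex_bij_betw[OF bij_betw_graph_of, symmetric])
    \<comment> \<open>The product lemma is about natural numbers; rewriting \<open>weight\<close>
      backwards with it lets \<open>int\<close> move inside the product.\<close>
    also have "\<dots> = W k"
      unfolding W_def
      by (rule sum.cong) (simp_all add: prod_psi_graph_of[OF assms(1), symmetric])
    finally show ?thesis .
  qed
  \<comment> \<open>No set of blocks exceeds \<open>n\<^sup>2\<close> elements, so grouping by
    cardinality up to this bound loses no term.\<close>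
  have card_le: "card ` ?P \<subseteq> {0..n\<^sup>2}"
  proof
    fix k assume "k \<in> card ` ?P"
    then obtain S where "S \<subseteq> {..<n} \<times> {..<n}" "k = card S" by auto
    then show "k \<in> {0..n\<^sup>2}"
      using card_mono[of "{..<n} \<times> {..<n}" S] by (simp add: power2_eq_square)
  qed
  \<comment> \<open>Infinite sets also have \<open>card\<close> 0; they are excluded as subsets of a
    finite grid.\<close>
  have empty: "{S \<in> ?P. card S = 0} = {{}}"
    by (auto dest: finite_subset)
  have W0: "W 0 = fact n ^ (2 * n)"
    unfolding W_def empty by (simp add: weight_def power_add mult_2)
  have "int (card {B \<in> S_permutation_mats n. disjoint_mats A B}) =
      (\<Sum>S\<in>?P. (- 1) ^ card S * int (weight n S))"
    by (rule card_disjoint_S_permutation_mats[OF assms(2)])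
  also have "\<dots> = (\<Sum>k = 0..n\<^sup>2. \<Sum>S\<in>{S. S \<in> ?P \<and> card S = k}. (- 1) ^ card S * int (weight n S))"
    by (rule sum.group[OF _ _ card_le, symmetric]) auto
  also have "\<dots> = (\<Sum>k = 0..n\<^sup>2. (- 1) ^ k * W k)"
    unfolding W_def sum_distrib_left by (intro sum.cong) auto
  also have "\<dots> = fact n ^ (2 * n) + (\<Sum>k = 1..n\<^sup>2. (- 1) ^ k * W k)"
    \<comment> \<open>Splitting off \<open>k = 0\<close> leaves the lower bound
      \<open>Suc 0\<close>. \<open>One_nat_def\<close>, removed from the simpset at the start, is
      restored to match it with 1.\<close>
    by (simp add: sum.atLeast_Suc_atMost W0 One_nat_def)
  finally show ?thesis unfolding W .
qed

end
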